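(* Let $A$ be a real symmetric $n\times n$ matrix with rank $r(A)\ge3$ and eigenvalues $\lambda_1,\dots,\lambda_n$ (with multiplicity). Let $1\le k\le n-1$ be such that $\lambda_1\le\cdots\le\lambda_k<0$ are the $k$ smallest eigenvalues of $A$ (the $k$ negative eigenvalues largest in absolute value), and suppose that $r(A)-k$ is even. Put $$a_k=\max_{k+1\le i\le n}|\lambda_i|,\qquad b_k=\sum_{i=1}^k\lambda_i,$$ and assume $a_k>0$. Let $\underline{\boldsymbol{x}}\sim N(\underline 0,I_n)$ and $\boldsymbol{\Delta}=\underline{\boldsymbol{x}}^{\mathsf T}A\underline{\boldsymbol{x}}-\mathrm{tr}(A)$. If $t>0$ satisfies $t+b_k\ge0$, then $$\Pr(\boldsymbol{\Delta}>t)\le e^{-\frac{t+b_k}{2a_k}}\sum_{l=0}^{\frac{r(A)-k}{2}}\frac{c_{k,l}}{\big(\frac{r(A)-k}{2}-l\big)!}\Big(1+\frac{t+b_k}{(r(A)-k)a_k}\Big)^{\frac{r(A)-k}{2}-l},$$ where $$c_{k,l}=\frac{\big(\frac{r(A)-k}{2}\big)!}{\prod_{i=1}^k\big(\frac{-\lambda_i}{a_k}+1\big)^{\frac12}}\sum_{\substack{j_1,\dots,j_k\ge0\\ j_1+\cdots+j_k=l}}\ \prod_{i=1}^k\frac{(2j_i-1)!!}{j_i!}\phi_i^{j_i},\qquad \phi_i=\frac{\frac{-\lambda_i}{(r(A)-k)a_k}}{\frac{-\lambda_i}{a_k}+1}.$$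
   Context: Convention: $(2j-1)!!=1$ for $j=0$ and $(2j-1)!!=1\cdot3\cdot5\cdots(2j-1)$ for $j\ge1$. The indices $j_1,\dots,j_k$ are nonnegative integers. *)

theory Defs
  imports "HOL-Probability.Probability" "HOL-Computational_Algebra.Polynomial"
begin

definition charpoly :: "real ^ 'n ^ 'n \<Rightarrow> real poly" where
  "charpoly A = det (mat [:0, 1:] - (\<chi> i j. [:A $ i $ j:]))"

text \<open>
  \<open>lam 1, \<dots>, lam n\<close> are the eigenvalues of \<open>A\<close>, each listed as often as its
  multiplicity as a root of the characteristic polynomial.
\<close>

definition eigenvalue_family :: "real ^ 'n ^ 'n \<Rightarrow> (nat \<Rightarrow> real) \<Rightarrow> bool" where
  "eigenvalue_family A lam \<longleftrightarrow> charpoly A = (\<Prod>i = 1..CARD('n). [:- lam i, 1:])"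

definition std_normal_vec_density :: "real ^ 'n \<Rightarrow> real" where
  "std_normal_vec_density x = exp (- (x \<bullet> x) / 2) / sqrt ((2 * pi) ^ CARD('n))"

text \<open>The double factorial \<open>(2 j - 1)!!\<close>; the empty product makes it 1 at \<open>j = 0\<close>.\<close>

definition odd_double_fact :: "nat \<Rightarrow> nat" where
  "odd_double_fact j = (\<Prod>i = 1..j. 2 * i - 1)"

text \<open>
  Tuples of nonnegative integers \<open>(j\<^sub>1, \<dots>, j\<^sub>k)\<close> with sum \<open>l\<close>. They are extensional
  functions on \<open>{1..k}\<close>, so that each tuple is counted exactly once; a sum over this
  set is a genuine finite sum because the set is finite.
\<close>

definition index_tuples :: "nat \<Rightarrow> nat \<Rightarrow> (nat \<Rightarrow> nat) set" where
  "index_tuples k l = {j \<in> {1..k} \<rightarrow>\<^sub>E UNIV. (\<Sum>i = 1..k. j i) = l}"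

lemma finite_index_tuples: "finite (index_tuples k l)"
proof (rule finite_subset)
  show "index_tuples k l \<subseteq> {1..k} \<rightarrow>\<^sub>E {..l}"
  proof
    fix j assume j: "j \<in> index_tuples k l"
    have "j i \<le> l" if "i \<in> {1..k}" for i
      using member_le_sum[of i "{1..k}" j] that j by (simp add: index_tuples_def)
    with j show "j \<in> {1..k} \<rightarrow>\<^sub>E {..l}"
      by (auto simp: index_tuples_def PiE_iff)
  qed
  show "finite ({1..k} \<rightarrow>\<^sub>E {..l})"
    by (intro finite_PiE) auto
qed

text \<open>In the next two definitions \<open>r\<close> is the rank of the matrix and \<open>a\<close> is \<open>a\<^sub>k\<close>.\<close>

definition phi :: "nat \<Rightarrow> nat \<Rightarrow> real \<Rightarrow> (nat \<Rightarrow> real) \<Rightarrow> nat \<Rightarrow> real" where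
  "phi r k a lam i =
     (- lam i / ((real r - real k) * a)) / (- lam i / a + 1)"

text \<open>
  For \<open>k < r\<close> with \<open>r - k\<close> even, \<open>(r - k) div 2\<close> is the exact half of \<open>r - k\<close>.
\<close>

definition tail_coeff :: "nat \<Rightarrow> nat \<Rightarrow> real \<Rightarrow> (nat \<Rightarrow> real) \<Rightarrow> nat \<Rightarrow> real" where
  "tail_coeff r k a lam l =
     fact ((r - k) div 2) / (\<Prod>i = 1..k. sqrt (- lam i / a + 1)) *
     (\<Sum>j \<in> index_tuples k l.
        \<Prod>i = 1..k. real (odd_double_fact (j i)) / fact (j i) * phi r k a lam i ^ j i)"

end

theory Submission
  imports Defs
begin

text \<open>
  Diagonalise. In an orthonormal eigenbasis, \<open>A\<close> is diagonal and the coordinates \<open>z\<^sub>1, \<dots>, z\<^sub>n\<close> of the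
  Gaussian vector are independent standard normal variables, so the centred quadratic form is the
  sum of the \<open>lam i * (z\<^sub>i\<^sup>2 - 1)\<close>. The spectral theorem is \<open>self_adjoint_orthonormal_eigenbasis\<close>; the
  characteristic polynomial makes the eigenvalues appear in the given order
  (\<open>eigenvalue_family_eigenframe\<close>), and rotation invariance of Lebesgue measure gives the law of the
  coordinates (\<open>nn_integral_std_normal_vec_in_frame\<close>).

  Condition on the first \<open>k\<close> coordinates. The form exceeds \<open>t\<close> exactly when the centred sum over the
  remaining indices exceeds \<open>s = t + b - (\<Sum>i\<le>k. lam i * z\<^sub>i\<^sup>2)\<close>, and \<open>s \<ge> t + b \<ge> 0\<close> since those
  eigenvalues are negative. The remaining eigenvalues have absolute value at most \<open>a\<close>, and the
  number \<open>m\<close> of nonzero ones is the rank minus \<open>k\<close>. For positive exponents their centred sum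
  has no larger exponential moments than \<open>a\<close> times a centred
  chi-square variable with \<open>m\<close> degrees of freedom, so the Chernoff bound with the exponent optimal for
  that \<open>s\<close> gives \<open>exp (- s / (2 * a)) * (1 + s / (m * a)) ^ (m / 2)\<close>, by \<open>chernoff_centred_squares\<close>.

  Since \<open>m\<close> is even, the power is polynomial in \<open>s\<close> and can be expanded by the binomial and multinomial
  theorems. Averaging over the first \<open>k\<close> coordinates then only requires the moments of \<open>z\<^sub>i\<^sup>2\<close> under
  the weight \<open>exp (lam i * z\<^sub>i\<^sup>2 / (2 * a))\<close>. These are Gaussian moments with a smaller variance and
  produce the double factorials, the square roots and the ratios \<open>phi\<close> in the coefficients, so the
  average equals the right-hand side (\<open>expected_chernoff_bound\<close>).
\<close>

section \<open>Orthonormal eigenbases of self-adjoint maps\<close>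

lemma nonneg_quadratic_imp_linear_coeff_zero:
  fixes L G :: real
  assumes nonneg: "\<And>s. s * L + s\<^sup>2 * G \<ge> 0"
  shows "L = 0"
proof (rule ccontr)
  assume "L \<noteq> 0"
  have G: "G \<ge> 0"
    using nonneg[of 1] nonneg[of "-1"] by simp
  \<comment> \<open>The minimiser \<open>- L / (2 * G)\<close> would need \<open>G > 0\<close>; with \<open>G + 1\<close> the value is \<open>- s\<^sup>2\<close>.\<close>
  define s where "s = - L / (G + 1)"
  have "s * (G + 1) = - L"
    using G by (simp add: s_def)
  then have "s * L + s\<^sup>2 * G = - (s\<^sup>2)"
    by (simp add: power2_eq_square) algebra
  moreover have "s \<noteq> 0"
    using G \<open>L \<noteq> 0\<close> by (simp add: s_def)
  ultimately show False
    using nonneg[of s] by simp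
qed

text \<open>
  A maximiser \<open>v\<close> of the quadratic form on the unit sphere of \<open>S\<close> is an eigenvector: with \<open>c\<close> the
  maximal value, \<open>c * (x \<bullet> x) - f x \<bullet> x\<close> is nonnegative on \<open>S\<close> and vanishes at \<open>v\<close>. Its
  derivative at \<open>v\<close> in the direction \<open>w = c *\<^sub>R v - f v\<close> is therefore zero; but this derivative is
  \<open>2 * (w \<bullet> w)\<close>.
\<close>

lemma self_adjoint_has_eigenvector:
  fixes f :: "'a::euclidean_space \<Rightarrow> 'a"
  assumes f: "linear f" and adj: "\<And>x y. f x \<bullet> y = x \<bullet> f y"
    and S: "subspace S" "f ` S \<subseteq> S" "dim S > 0"
  obtains v c where "v \<in> S" "norm v = 1" "f v = c *\<^sub>R v"
proof -
  let ?K = "S \<inter> sphere 0 1"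
  obtain u where u: "u \<in> S" "u \<noteq> 0"
    using \<open>dim S > 0\<close> dim_eq_0[of S] by fastforce
  have "u /\<^sub>R norm u \<in> ?K"
    using u S(1) by (simp add: subspace_scale)
  then have ne: "?K \<noteq> {}" by blast
  have comp: "compact ?K"
    using closed_subspace[OF S(1)] by (simp add: closed_Int_compact)
  have "continuous_on ?K (\<lambda>x. f x \<bullet> x)"
    by (intro continuous_intros linear_continuous_on linear_conv_bounded_linear[THEN iffD1] f)
  with comp ne obtain v where v: "v \<in> ?K" and max: "\<And>x. x \<in> ?K \<Longrightarrow> f x \<bullet> x \<le> f v \<bullet> v"
    using continuous_attains_sup[of ?K "\<lambda>x. f x \<bullet> x"] by blast
  define c where "c = f v \<bullet> v"
  have vS: "v \<in> S" and vn: "norm v = 1" using v by auto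
  have le: "f x \<bullet> x \<le> c * (x \<bullet> x)" if "x \<in> S" for x
  proof (cases "x = 0")
    case False
    have "f (x /\<^sub>R norm x) \<bullet> (x /\<^sub>R norm x) \<le> c"
      unfolding c_def by (rule max) (use that False S(1) in \<open>simp add: subspace_scale\<close>)
    then show ?thesis
      using False by (simp add: linear_scale[OF f] dot_square_norm power2_eq_square field_simps)
  qed (simp add: linear_0[OF f])
  define w where "w = c *\<^sub>R v - f v"
  have wS: "w \<in> S"
    using vS S by (auto simp: w_def intro!: subspace_diff subspace_scale)
  have "s * (2 * (w \<bullet> w)) + s\<^sup>2 * (c * (w \<bullet> w) - f w \<bullet> w) \<ge> 0" for s
  proof -
    have "v + s *\<^sub>R w \<in> S"
      using vS wS S(1) by (simp add: subspace_add subspace_scale)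
    from le[OF this]
    have "f v \<bullet> v + s * (f v \<bullet> w) + s * (f w \<bullet> v) + s\<^sup>2 * (f w \<bullet> w)
        \<le> c * (v \<bullet> v + 2 * s * (v \<bullet> w) + s\<^sup>2 * (w \<bullet> w))"
      by (simp add: linear_add[OF f] linear_scale[OF f] inner_add_left inner_add_right
          inner_commute[of w v] power2_eq_square algebra_simps)
    moreover have "v \<bullet> v = 1" using vn by (simp add: dot_square_norm)
    moreover have "f w \<bullet> v = f v \<bullet> w" by (metis adj inner_commute)
    moreover have "s * (2 * (w \<bullet> w)) = s * (2 * (c * (v \<bullet> w) - f v \<bullet> w))"
      using arg_cong[OF w_def, of "\<lambda>z. z \<bullet> w"] by (simp add: inner_diff_left)
    moreover have "f v \<bullet> v = c" by (simp add: c_def)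
    ultimately show ?thesis
      by (simp add: algebra_simps)
  qed
  then have "2 * (w \<bullet> w) = 0"
    by (rule nonneg_quadratic_imp_linear_coeff_zero)
  then have "f v = c *\<^sub>R v" by (simp add: w_def)
  with vS vn that show thesis by blast
qed

text \<open>
  Splitting off one unit eigenvector \<open>v\<close> leaves the orthogonal complement of \<open>v\<close> in \<open>S\<close>, which is
  again invariant because \<open>f x \<bullet> v = x \<bullet> f v\<close> is a multiple of \<open>x \<bullet> v\<close>, and has smaller dimension.
\<close>

theorem self_adjoint_orthonormal_eigenbasis:
  fixes f :: "'a::euclidean_space \<Rightarrow> 'a"
  assumes f: "linear f" and adj: "\<And>x y. f x \<bullet> y = x \<bullet> f y"
    and S: "subspace S" "f ` S \<subseteq> S"
  obtains B where "pairwise orthogonal B" "\<And>x. x \<in> B \<Longrightarrow> norm x = 1" "span B = S"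
    "\<And>x. x \<in> B \<Longrightarrow> \<exists>c. f x = c *\<^sub>R x"
proof -
  have "\<exists>B. pairwise orthogonal B \<and> (\<forall>x\<in>B. norm x = 1) \<and> span B = S
      \<and> (\<forall>x\<in>B. \<exists>c. f x = c *\<^sub>R x)"
    using S
  proof (induction "dim S" arbitrary: S rule: less_induct)
    case less
    note S = less.prems
    show ?case
    proof (cases "dim S = 0")
      case True
      then have "S = {0}"
        using subspace_0[OF S(1)] by auto
      then show ?thesis by (intro exI[of _ "{}"]) auto
    next
      case False
      then obtain v c where v: "v \<in> S" "norm v = 1" "f v = c *\<^sub>R v"
        using self_adjoint_has_eigenvector[OF f adj S] by blast
      have vv: "v \<bullet> v = 1" using v(2) by (simp add: dot_square_norm)
      let ?T = "{x \<in> S. x \<bullet> v = 0}"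
      have T: "subspace ?T"
        using S(1) by (auto simp: subspace_def inner_add_left)
      have fT: "f ` ?T \<subseteq> ?T"
        using S(2) by (auto simp: adj v(3))
      have "v \<notin> ?T" using vv by simp
      then have "?T \<subset> S" using v(1) by blast
      then have "dim ?T < dim S"
        using dim_psubset[of ?T S] T S(1) by (simp add: span_eq_iff[THEN iffD2])
      from less.hyps[OF this T fT] obtain B where
        B: "pairwise orthogonal B" "\<forall>x\<in>B. norm x = 1" "span B = ?T" "\<forall>x\<in>B. \<exists>c. f x = c *\<^sub>R x"
        by blast
      have BT: "B \<subseteq> ?T" using B(3) span_superset by blast
      have "span (insert v B) = S"
      proof (rule span_unique)
        show "insert v B \<subseteq> S" using BT v(1) by auto
        show "subspace S" by fact
        fix S' assume S': "insert v B \<subseteq> S'" "subspace S'"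
        show "S \<subseteq> S'"
        proof
          fix x assume "x \<in> S"
          then have "x - (x \<bullet> v) *\<^sub>R v \<in> ?T"
            using S(1) v(1) vv by (auto simp: inner_diff_left intro: subspace_diff subspace_scale)
          moreover have "?T \<subseteq> S'"
            using S' B(3) span_minimal[of B S'] by auto
          moreover have "(x \<bullet> v) *\<^sub>R v \<in> S'"
            using S' by (auto intro: subspace_scale)
          ultimately have "(x - (x \<bullet> v) *\<^sub>R v) + (x \<bullet> v) *\<^sub>R v \<in> S'"
            using S'(2) by (blast intro: subspace_add)
          then show "x \<in> S'" by simp
        qed
      qed
      moreover have "pairwise orthogonal (insert v B)"
        using B(1) BT by (auto simp: pairwise_insert orthogonal_def inner_commute)
      ultimately show ?thesis
        using B v by (intro exI[of _ "insert v B"]) auto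
    qed
  qed
  then show thesis using that by blast
qed

lemma symmetric_matrix_inner:
  fixes A :: "real ^ 'n ^ 'n"
  assumes "transpose A = A"
  shows "(A *v x) \<bullet> y = x \<bullet> (A *v y)"
  using dot_lmul_matrix[of x A y] assms by (metis vector_transpose_matrix)

text \<open>
  Orthonormal bases are indexed by \<open>1, \<dots>, n\<close>, like the eigenvalues, so that the first \<open>k\<close> of them
  can be separated from the others.
\<close>

definition orthonormal_frame :: "(nat \<Rightarrow> real ^ 'n) \<Rightarrow> bool" where
  "orthonormal_frame v \<longleftrightarrow>
     (\<forall>i\<in>{1..CARD('n)}. \<forall>j\<in>{1..CARD('n)}. v i \<bullet> v j = (if i = j then 1 else 0))"

lemma symmetric_matrix_eigenframe:
  fixes A :: "real ^ 'n ^ 'n"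
  assumes "transpose A = A"
  obtains v mu where "orthonormal_frame v" "\<And>i. i \<in> {1..CARD('n)} \<Longrightarrow> A *v v i = mu i *\<^sub>R v i"
proof -
  obtain B where B: "pairwise orthogonal B" "\<And>x. x \<in> B \<Longrightarrow> norm x = 1" "span B = UNIV"
    "\<And>x. x \<in> B \<Longrightarrow> \<exists>c. A *v x = c *\<^sub>R x"
    using self_adjoint_orthonormal_eigenbasis[of "(*v) A" UNIV]
      symmetric_matrix_inner[OF assms] by auto
  have ind: "independent B"
    using B(1,2) by (intro pairwise_orthogonal_independent) force+
  then have "card B = dim (span B)" using indep_card_eq_dim_span by blast
  then have card: "card B = CARD('n)" unfolding B(3) by (simp add: dim_UNIV)
  have "finite B" using ind independent_imp_finite by blast
  then obtain v where v: "bij_betw v {1..CARD('n)} B"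
    using card finite_same_card_bij[of "{1..CARD('n)}" B] by auto
  obtain c where c: "\<And>x. x \<in> B \<Longrightarrow> A *v x = c x *\<^sub>R x"
    using B(4) by metis
  have "orthonormal_frame v"
    unfolding orthonormal_frame_def
  proof (intro ballI)
    fix i j assume ij: "i \<in> {1..CARD('n)}" "j \<in> {1..CARD('n)}"
    then have "v i \<in> B" "v j \<in> B" "v i = v j \<longleftrightarrow> i = j"
      using v by (auto simp: bij_betw_def inj_on_eq_iff)
    then show "v i \<bullet> v j = (if i = j then 1 else 0)"
      using B(1,2) by (auto simp: pairwise_def orthogonal_def dot_square_norm)
  qed
  moreover have "A *v v i = c (v i) *\<^sub>R v i" if "i \<in> {1..CARD('n)}" for i
    using c v that by (auto simp: bij_betw_def)
  ultimately show thesis using that[of v "\<lambda>i. c (v i)"] by blast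
qed

section \<open>Eigenframes carrying a prescribed list of eigenvalues\<close>

text \<open>
  Columns of a matrix are indexed by \<open>'n\<close> and frames by numbers; the bijection \<open>e\<close> translates.
\<close>

lemma orthonormal_frame_matrix:
  fixes v :: "nat \<Rightarrow> real ^ 'n"
  assumes "orthonormal_frame v"
  obtains Q :: "real ^ 'n ^ 'n" and e where "orthogonal_matrix Q" "bij_betw e UNIV {1..CARD('n)}"
    "\<And>c. column c Q = v (e c)"
proof -
  obtain e where e: "bij_betw e (UNIV::'n set) {1..CARD('n)}"
    using finite_same_card_bij[of "UNIV::'n set" "{1..CARD('n)}"] by auto
  define Q :: "real ^ 'n ^ 'n" where "Q = (\<chi> r c. v (e c) $ r)"
  have col: "column c Q = v (e c)" for c
    by (simp add: Q_def column_def vec_eq_iff)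
  have mem: "e c \<in> {1..CARD('n)}" for c
    using e by (auto simp: bij_betw_def)
  have "v (e c) \<bullet> v (e d) = (if c = d then 1 else 0)" for c d
    using assms mem[of c] mem[of d] bij_betw_imp_inj_on[OF e]
    by (simp add: orthonormal_frame_def inj_on_eq_iff)
  then have "orthogonal_matrix Q"
    by (simp add: orthogonal_matrix_orthonormal_columns col orthogonal_def norm_eq_1)
  with e col that show thesis by blast
qed

lemma orthonormal_frame_span:
  fixes v :: "nat \<Rightarrow> real ^ 'n"
  assumes "orthonormal_frame v"
  shows "span (v ` {1..CARD('n)}) = UNIV"
proof -
  let ?I = "{1..CARD('n)}"
  have inj: "inj_on v ?I"
  proof (rule inj_onI)
    fix i j assume "i \<in> ?I" "j \<in> ?I" "v i = v j"
    then show "i = j"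
      using assms unfolding orthonormal_frame_def by (metis zero_neq_one)
  qed
  have "independent (v ` ?I)"
  proof (rule pairwise_orthogonal_independent)
    show "pairwise orthogonal (v ` ?I)"
      using assms by (auto simp: pairwise_def orthogonal_def orthonormal_frame_def)
    show "0 \<notin> v ` ?I"
      using assms by (force simp: orthonormal_frame_def)
  qed
  then show ?thesis
    using card_image[OF inj] card_eq_dim[of "v ` ?I" UNIV] by (auto simp: dim_UNIV)
qed

lemma poly_charpoly:
  fixes A :: "real ^ 'n ^ 'n"
  shows "poly (charpoly A) x = det (mat x - A)"
proof -
  have "poly ((mat [:0, 1:] - (\<chi> i j. [:A $ i $ j:])) $ i $ j) x = (mat x - A) $ i $ j" for i j
    by (simp add: mat_def)
  then show ?thesis
    unfolding charpoly_def det_def by (simp only: poly_sum poly_mult poly_prod poly_of_int)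
qed

locale eigenframe =
  fixes A :: "real ^ 'n ^ 'n" and v :: "nat \<Rightarrow> real ^ 'n" and mu :: "nat \<Rightarrow> real"
  assumes frame: "orthonormal_frame v"
    and eigen: "i \<in> {1..CARD('n)} \<Longrightarrow> A *v v i = mu i *\<^sub>R v i"
begin

lemma diagonalise:
  obtains Q :: "real ^ 'n ^ 'n" and e where "orthogonal_matrix Q" "bij_betw e UNIV {1..CARD('n)}"
    "A ** Q = Q ** (\<chi> c d. if c = d then mu (e c) else 0)"
proof -
  obtain Q :: "real ^ 'n ^ 'n" and e where Q: "orthogonal_matrix Q" "bij_betw e UNIV {1..CARD('n)}"
    "\<And>c. column c Q = v (e c)"
    using orthonormal_frame_matrix[OF frame] by blast
  have mem: "e c \<in> {1..CARD('n)}" for c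
    using Q(2) by (auto simp: bij_betw_def)
  have "A ** Q = Q ** (\<chi> c d. if c = d then mu (e c) else 0)"
  proof (subst vec_eq_iff, intro allI, subst vec_eq_iff, intro allI)
    fix r c
    have "(A ** Q) $ r $ c = (A *v column c Q) $ r"
      by (simp add: matrix_matrix_mult_def matrix_vector_mult_def column_def)
    also have "\<dots> = mu (e c) * column c Q $ r"
      by (simp add: Q(3) eigen[OF mem])
    also have "\<dots> = (Q ** (\<chi> c d. if c = d then mu (e c) else 0)) $ r $ c"
      by (simp add: matrix_matrix_mult_def column_def if_distrib mult.commute cong: if_cong)
    finally show "(A ** Q) $ r $ c = (Q ** (\<chi> c d. if c = d then mu (e c) else 0)) $ r $ c" .
  qed
  with Q that show thesis by blast
qed

lemma trace_eq_sum: "trace A = (\<Sum>i = 1..CARD('n). mu i)"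
proof -
  obtain Q :: "real ^ 'n ^ 'n" and e where Q: "orthogonal_matrix Q" "bij_betw e UNIV {1..CARD('n)}"
    "A ** Q = Q ** (\<chi> c d. if c = d then mu (e c) else 0)"
    by (rule diagonalise)
  let ?D = "(\<chi> c d. if c = d then mu (e c) else 0) :: real ^ 'n ^ 'n"
  have "A = (Q ** ?D) ** transpose Q"
    using Q(1,3) by (metis matrix_mul_assoc matrix_mul_rid orthogonal_matrix_def)
  then have "trace A = trace ((Q ** ?D) ** transpose Q)"
    by (rule arg_cong)
  also have "\<dots> = trace (transpose Q ** (Q ** ?D))"
    by (rule trace_mul_sym)
  also have "transpose Q ** (Q ** ?D) = ?D"
    using Q(1) by (simp add: matrix_mul_assoc orthogonal_matrix_def)
  also have "trace ?D = (\<Sum>c\<in>UNIV. mu (e c))" by (simp add: trace_def)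
  also have "\<dots> = (\<Sum>i = 1..CARD('n). mu i)"
    by (rule sum.reindex_bij_betw[OF Q(2)])
  finally show ?thesis .
qed

text \<open>
  Evaluating at a real \<open>x\<close> turns the determinant over polynomials into one over the reals, where
  \<open>Q\<close> can be cancelled from \<open>(mat x - A) ** Q = Q ** (mat x - D)\<close>.
\<close>

lemma charpoly_eq_prod: "charpoly A = (\<Prod>i = 1..CARD('n). [:- mu i, 1:])"
proof -
  obtain Q :: "real ^ 'n ^ 'n" and e where Q: "orthogonal_matrix Q" "bij_betw e UNIV {1..CARD('n)}"
    "A ** Q = Q ** (\<chi> c d. if c = d then mu (e c) else 0)"
    by (rule diagonalise)
  let ?D = "(\<chi> c d. if c = d then mu (e c) else 0) :: real ^ 'n ^ 'n"
  have "poly (charpoly A) x = poly (\<Prod>i = 1..CARD('n). [:- mu i, 1:]) x" for x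
  proof -
    have "mat x ** Q = Q ** mat x"
      by (simp add: vec_eq_iff matrix_matrix_mult_def mat_def if_distrib if_distribR mult.commute cong: if_cong)
    moreover have "(mat x - A) ** Q = mat x ** Q - A ** Q" "Q ** (mat x - ?D) = Q ** mat x - Q ** ?D"
      by (simp_all add: vec_eq_iff matrix_matrix_mult_def left_diff_distrib right_diff_distrib sum_subtractf)
    ultimately have "(mat x - A) ** Q = Q ** (mat x - ?D)"
      using Q(3) by simp
    from arg_cong[OF this, of det] have "det (mat x - A) * det Q = det Q * det (mat x - ?D)"
      by (simp only: det_mul)
    moreover have "det Q \<noteq> 0"
      using det_orthogonal_matrix[OF Q(1)] by auto
    ultimately have "det (mat x - A) = det (mat x - ?D)" by simp
    also have "\<dots> = (\<Prod>c\<in>UNIV. x - mu (e c))"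
      by (subst det_diagonal) (auto simp: mat_def)
    also have "\<dots> = (\<Prod>i = 1..CARD('n). x - mu i)"
      by (rule prod.reindex_bij_betw[OF Q(2)])
    finally show ?thesis by (simp add: poly_charpoly poly_prod)
  qed
  then show ?thesis by (simp add: poly_eq_poly_eq_iff[symmetric] fun_eq_iff)
qed

text \<open>
  The range of \<open>A\<close> is spanned by the vectors \<open>mu i *\<^sub>R v i\<close>, of which the nonzero ones are orthogonal
  and hence independent.
\<close>

lemma rank_eq_card: "rank A = card {i \<in> {1..CARD('n)}. mu i \<noteq> 0}"
proof -
  let ?I = "{1..CARD('n)}" and ?J = "{i \<in> {1..CARD('n)}. mu i \<noteq> 0}"
  let ?w = "\<lambda>i. mu i *\<^sub>R v i"
  have inj: "inj_on ?w ?J"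
  proof (rule inj_onI)
    fix i j assume ij: "i \<in> ?J" "j \<in> ?J" "?w i = ?w j"
    have "mu i * (v i \<bullet> v i) = mu j * (v j \<bullet> v i)"
      using arg_cong[OF ij(3), of "\<lambda>x. x \<bullet> v i"] by simp
    with ij(1,2) show "i = j"
      using frame by (auto simp: orthonormal_frame_def split: if_splits)
  qed
  have "range ((*v) A) = span ((*v) A ` (v ` ?I))"
    using orthonormal_frame_span[OF frame] linear_span_image[of "(*v) A" "v ` ?I"] by simp
  also have "(*v) A ` (v ` ?I) = ?w ` ?I"
    using eigen by (auto simp: image_image intro!: image_cong)
  also have "span (?w ` ?I) = span (?w ` ?I - {0})" by simp
  also have "?w ` ?I - {0} = ?w ` ?J"
  proof -
    have "v i \<noteq> 0" if "i \<in> ?I" for i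
      using frame that by (force simp: orthonormal_frame_def)
    then show ?thesis by auto
  qed
  finally have "rank A = dim (?w ` ?J)"
    by (simp add: rank_dim_range)
  also have "\<dots> = card (?w ` ?J)"
  proof (rule dim_eq_card_independent, rule pairwise_orthogonal_independent)
    show "pairwise orthogonal (?w ` ?J)"
      using frame by (auto simp: pairwise_def orthogonal_def orthonormal_frame_def)
    show "0 \<notin> ?w ` ?J"
      using frame by (force simp: orthonormal_frame_def)
  qed
  also have "\<dots> = card ?J" by (rule card_image[OF inj])
  finally show ?thesis .
qed

end

lemma linear_factors_determine_multiset:
  fixes f g :: "'i \<Rightarrow> 'a::idom"
  assumes "finite I" "(\<Prod>i\<in>I. [:- f i, 1:]) = (\<Prod>i\<in>I. [:- g i, 1:])"
  shows "image_mset f (mset_set I) = image_mset g (mset_set I)"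
proof -
  have "proots (\<Prod>i\<in>I. [:- h i, 1:]) = image_mset h (mset_set I)" for h :: "'i \<Rightarrow> 'a"
    by (subst proots_prod) (use assms(1) in \<open>auto simp: sum_unfold_sum_mset image_mset.compositionality o_def\<close>)
  with assms(2) show ?thesis by metis
qed

text \<open>
  The characteristic polynomial determines the multiset of eigenvalues, so an eigenframe can be
  permuted until its eigenvalues appear in the order of the given list.
\<close>

theorem eigenvalue_family_eigenframe:
  fixes A :: "real ^ 'n ^ 'n"
  assumes "transpose A = A" "eigenvalue_family A lam"
  obtains v where "eigenframe A v lam"
proof -
  obtain v mu where vm: "orthonormal_frame v" "\<And>i. i \<in> {1..CARD('n)} \<Longrightarrow> A *v v i = mu i *\<^sub>R v i"
    using symmetric_matrix_eigenframe[OF assms(1)] by blast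
  interpret eigenframe A v mu by standard fact+
  have "image_mset lam (mset_set {1..CARD('n)}) = image_mset mu (mset_set {1..CARD('n)})"
    using assms(2) charpoly_eq_prod
    by (intro linear_factors_determine_multiset) (auto simp: eigenvalue_family_def)
  then obtain p where p: "p permutes {1..CARD('n)}" "\<forall>i\<in>{1..CARD('n)}. lam i = mu (p i)"
    using image_mset_eq_implies_permutes[of "{1..CARD('n)}" lam mu] by blast
  have "eigenframe A (v \<circ> p) lam"
  proof
    show "orthonormal_frame (v \<circ> p)"
      using frame permutes_in_image[OF p(1)] permutes_inj[OF p(1)]
      by (auto simp: orthonormal_frame_def inj_eq)
  qed (use p vm(2) permutes_in_image[OF p(1)] in auto)
  then show thesis by (rule that)
qed

section \<open>Gaussian vectors in an orthonormal frame\<close>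

lemma orthonormal_frame_inner_sum:
  fixes v :: "nat \<Rightarrow> real ^ 'n"
  assumes "orthonormal_frame v"
  shows "(\<Sum>i = 1..CARD('n). x i *\<^sub>R v i) \<bullet> (\<Sum>i = 1..CARD('n). y i *\<^sub>R v i)
    = (\<Sum>i = 1..CARD('n). x i * y i)"
proof -
  have "(\<Sum>i = 1..CARD('n). y j * (x i * (v i \<bullet> v j))) = x j * y j" if "j \<in> {1..CARD('n)}" for j
  proof -
    have "(\<Sum>i = 1..CARD('n). y j * (x i * (v i \<bullet> v j))) = (\<Sum>i = 1..CARD('n). if i = j then x j * y j else 0)"
      using assms that by (intro sum.cong refl) (auto simp: orthonormal_frame_def)
    with that show ?thesis by simp
  qed
  then show ?thesis
    by (simp add: inner_sum_left inner_sum_right sum_distrib_left)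
qed

lemma (in eigenframe) quadratic_form_in_frame:
  "(\<Sum>i = 1..CARD('n). x i *\<^sub>R v i) \<bullet> (A *v (\<Sum>i = 1..CARD('n). x i *\<^sub>R v i))
    = (\<Sum>i = 1..CARD('n). mu i * (x i)\<^sup>2)"
proof -
  have "A *v (\<Sum>i = 1..CARD('n). x i *\<^sub>R v i) = (\<Sum>i = 1..CARD('n). (x i * mu i) *\<^sub>R v i)"
    by (simp add: linear_sum linear_scale eigen)
  then show ?thesis
    using orthonormal_frame_inner_sum[OF frame] by (simp add: power2_eq_square mult_ac)
qed

lemma nn_integral_lborel_translate:
  fixes f :: "'a::euclidean_space \<Rightarrow> ennreal"
  assumes [measurable]: "f \<in> borel_measurable borel"
  shows "(\<integral>\<^sup>+x. f (c + x) \<partial>lborel) = (\<integral>\<^sup>+x. f x \<partial>lborel)"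
  by (subst (2) lborel_distr_plus[of c, symmetric]) (simp add: nn_integral_distr)

text \<open>
  This is the uniqueness argument for Haar measure. Let \<open>g\<close> be the indicator of the unit ball.
  Integrating \<open>g y * indicator B (y + f x)\<close> over \<open>x\<close> first gives the measure of the ball times that of
  the preimage of \<open>B\<close>; integrating over \<open>y\<close> first, after the translation \<open>y \<mapsto> y - f x\<close>, gives the
  measure of the ball times that of \<open>B\<close>, because \<open>f\<close> maps unit balls onto unit balls. The measure of
  the ball is positive and finite and cancels.
\<close>

lemma lborel_distr_orthogonal_transformation:
  fixes f :: "'a::euclidean_space \<Rightarrow> 'a"
  assumes f: "orthogonal_transformation f"
  shows "distr lborel borel f = lborel"
proof (rule measure_eqI)
  show "sets (distr lborel borel f) = sets lborel" by simp
  have lin: "linear f" and bij: "bij f" and nrm: "\<And>x. norm (f x) = norm x"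
    using f by (simp_all add: orthogonal_transformation_linear orthogonal_transformation_bij
        orthogonal_transformation_norm)
  have [measurable]: "f \<in> borel_measurable borel"
    by (intro borel_measurable_continuous_onI linear_continuous_on linear_conv_bounded_linear[THEN iffD1] lin)
  fix B assume "B \<in> sets (distr lborel borel f)"
  then have [measurable]: "B \<in> sets borel" by simp
  let ?c = "emeasure lborel (ball 0 1 :: 'a set)"
  let ?g = "indicator (ball 0 1) :: 'a \<Rightarrow> ennreal" and ?b = "indicator B :: 'a \<Rightarrow> ennreal"
  have [measurable]: "ball 0 1 \<in> sets (borel :: 'a measure)" by simp
  have [measurable]: "f -` B \<in> sets borel"
    using measurable_sets[of f borel borel B] by simp
  have inner: "(\<integral>\<^sup>+x. ?g (y - f x) \<partial>lborel) = ?c" for y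
  proof -
    obtain z where z: "f z = y" using bij by (metis bij_pointE)
    have "?g (y - f x) = ?g (- z + x)" for x
      using nrm[of "z - x"] z
      by (simp add: indicator_def dist_norm linear_diff[OF lin] norm_minus_commute)
    then have "(\<integral>\<^sup>+x. ?g (y - f x) \<partial>lborel) = (\<integral>\<^sup>+x. ?g (- z + x) \<partial>lborel)"
      by simp
    also have "\<dots> = ?c"
      by (subst nn_integral_lborel_translate) auto
    finally show ?thesis .
  qed
  have "?c * emeasure lborel (f -` B) = (\<integral>\<^sup>+y. ?g y * emeasure lborel (f -` B) \<partial>lborel)"
    by (subst nn_integral_multc) auto
  also have "\<dots> = (\<integral>\<^sup>+y. (\<integral>\<^sup>+x. ?g y * ?b (y + f x) \<partial>lborel) \<partial>lborel)"
  proof (rule nn_integral_cong)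
    fix y
    obtain z where z: "f z = y" using bij by (metis bij_pointE)
    have "emeasure lborel (f -` B) = (\<integral>\<^sup>+x. ?b (f x) \<partial>lborel)"
      by (simp add: indicator_vimage[symmetric])
    also have "\<dots> = (\<integral>\<^sup>+x. ?b (f (z + x)) \<partial>lborel)"
      by (subst nn_integral_lborel_translate) auto
    finally show "?g y * emeasure lborel (f -` B) = (\<integral>\<^sup>+x. ?g y * ?b (y + f x) \<partial>lborel)"
      by (subst nn_integral_cmult) (auto simp: linear_add[OF lin] z)
  qed
  also have "\<dots> = (\<integral>\<^sup>+x. (\<integral>\<^sup>+y. ?g y * ?b (y + f x) \<partial>lborel) \<partial>lborel)"
    by (rule lborel_pair.Fubini') simp
  also have "\<dots> = (\<integral>\<^sup>+x. (\<integral>\<^sup>+y. ?g (y - f x) * ?b y \<partial>lborel) \<partial>lborel)"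
  proof (rule nn_integral_cong)
    fix x
    show "(\<integral>\<^sup>+y. ?g y * ?b (y + f x) \<partial>lborel) = (\<integral>\<^sup>+y. ?g (y - f x) * ?b y \<partial>lborel)"
      using nn_integral_lborel_translate[of "\<lambda>y. ?g (y - f x) * ?b y" "f x"]
      by (simp add: add.commute)
  qed
  also have "\<dots> = (\<integral>\<^sup>+y. (\<integral>\<^sup>+x. ?g (y - f x) * ?b y \<partial>lborel) \<partial>lborel)"
    by (rule lborel_pair.Fubini'[symmetric]) simp
  also have "\<dots> = (\<integral>\<^sup>+y. ?c * ?b y \<partial>lborel)"
    by (rule nn_integral_cong, subst nn_integral_multc) (auto simp: inner)
  also have "\<dots> = ?c * emeasure lborel B"
    by (subst nn_integral_cmult) auto
  finally have "?c * emeasure lborel (f -` B) = ?c * emeasure lborel B" .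
  moreover have "?c < \<infinity>"
    by (rule emeasure_lborel_ball_finite)
  moreover have "?c \<noteq> 0"
  proof
    assume "?c = 0"
    then have "measure lborel (ball 0 1 :: 'a set) = 0" by (simp add: measure_def)
    with content_ball_pos[of 1 "0::'a"] show False by simp
  qed
  ultimately have "emeasure lborel (f -` B) = emeasure lborel B"
    by (metis ennreal_mult_cancel_left infinity_ennreal_def less_irrefl)
  moreover have "emeasure (distr lborel borel f) B = emeasure lborel (f -` B \<inter> space lborel)"
    by (rule emeasure_distr) measurable
  ultimately show "emeasure (distr lborel borel f) B = emeasure lborel B"
    by simp
qed

lemma lborel_vec_eq_distr_PiM:
  assumes e: "bij_betw e (UNIV :: 'n::finite set) (I :: 'i set)"
  shows "lborel = distr (\<Pi>\<^sub>M i\<in>I. lborel) borel (\<lambda>z. (\<chi> c. z (e c)) :: real ^ 'n)"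
proof (rule lborel_eqI)
  interpret product_sigma_finite "\<lambda>_::'i. lborel :: real measure" by standard
  have fin: "finite I" using bij_betw_finite[OF e] by simp
  have mem: "e c \<in> I" for c using e by (auto simp: bij_betw_def)
  have inv: "inv e (e c) = c" for c using e by (simp add: bij_betw_def)
  have meas[measurable]: "(\<lambda>z. (\<chi> c. z (e c)) :: real ^ 'n) \<in> borel_measurable (\<Pi>\<^sub>M i\<in>I. lborel)"
    by (subst borel_measurable_euclidean_space)
       (auto simp: Basis_vec_def inner_axis mem)
  fix l u :: "real ^ 'n" assume le: "\<And>b. b \<in> Basis \<Longrightarrow> l \<bullet> b \<le> u \<bullet> b"
  have le': "l $ c \<le> u $ c" for c
  proof -
    have "axis c (1::real) \<in> Basis" by (auto simp: Basis_vec_def)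
    from le[OF this] show ?thesis by (simp add: inner_axis)
  qed
  have inv': "e (inv e i) = i" if "i \<in> I" for i
    using e that by (auto simp: bij_betw_def)
  have "(\<lambda>z. (\<chi> c. z (e c)) :: real ^ 'n) -` box l u \<inter> space (\<Pi>\<^sub>M i\<in>I. lborel)
      = (\<Pi>\<^sub>E i\<in>I. {l $ inv e i <..< u $ inv e i})"
  proof (intro set_eqI)
    fix z :: "'i \<Rightarrow> real"
    have "((\<chi> c. z (e c)) :: real ^ 'n) \<in> box l u \<longleftrightarrow> (\<forall>c. l $ c < z (e c) \<and> z (e c) < u $ c)"
      by (simp add: mem_box_cart)
    also have "\<dots> \<longleftrightarrow> (\<forall>i\<in>I. l $ inv e i < z i \<and> z i < u $ inv e i)"
      using mem inv inv' by metis
    finally show "z \<in> (\<lambda>z. (\<chi> c. z (e c)) :: real ^ 'n) -` box l u \<inter> space (\<Pi>\<^sub>M i\<in>I. lborel)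
        \<longleftrightarrow> z \<in> (\<Pi>\<^sub>E i\<in>I. {l $ inv e i <..< u $ inv e i})"
      by (auto simp: space_PiM PiE_iff)
  qed
  then have "emeasure (distr (\<Pi>\<^sub>M i\<in>I. lborel) borel (\<lambda>z. (\<chi> c. z (e c)) :: real ^ 'n)) (box l u)
      = (\<Prod>i\<in>I. emeasure lborel {l $ inv e i <..< u $ inv e i})"
    by (simp add: emeasure_distr emeasure_PiM fin)
  also have "\<dots> = (\<Prod>c\<in>UNIV. emeasure lborel {l $ c <..< u $ c})"
    by (subst prod.reindex_bij_betw[OF e, symmetric]) (simp add: inv)
  also have "\<dots> = (\<Prod>c\<in>UNIV. ennreal ((u - l) \<bullet> axis c 1))"
    using le' by (simp add: inner_axis)
  also have "\<dots> = ennreal (\<Prod>c\<in>UNIV. (u - l) \<bullet> axis c 1)"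
    using le' by (intro prod_ennreal) (simp add: inner_axis)
  also have "(\<Prod>c\<in>UNIV. (u - l) \<bullet> axis c 1) = (\<Prod>b\<in>Basis. (u - l) \<bullet> b)"
  proof -
    have B: "(Basis :: (real ^ 'n) set) = range (\<lambda>c. axis c 1)" by (auto simp: Basis_vec_def)
    have inj: "inj (\<lambda>c. axis c 1 :: real ^ 'n)" by (auto simp: inj_def axis_eq_axis)
    show ?thesis unfolding B by (subst prod.reindex[OF inj]) (simp add: o_def)
  qed
  finally show "emeasure (distr (\<Pi>\<^sub>M i\<in>I. lborel) borel (\<lambda>z. (\<chi> c. z (e c)) :: real ^ 'n)) (box l u)
      = ennreal (\<Prod>b\<in>Basis. (u - l) \<bullet> b)" .
qed simp

abbreviation std_normal :: "real measure" where
  "std_normal \<equiv> density lborel (\<lambda>x. ennreal (std_normal_density x))"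

lemma product_prob_space_std_normal: "product_prob_space (\<lambda>_. std_normal)"
proof -
  interpret prob_space std_normal by (rule prob_space_normal_density) simp
  show ?thesis by unfold_locales
qed

text \<open>
  Both measures agree on boxes, where the integral of the product density factorises.
\<close>

lemma PiM_std_normal_eq_density:
  assumes "finite I"
  shows "(\<Pi>\<^sub>M i\<in>I. std_normal)
    = density (\<Pi>\<^sub>M i\<in>I. lborel) (\<lambda>z. \<Prod>i\<in>I. ennreal (std_normal_density (z (i::nat))))"
proof -
  interpret P: product_prob_space "\<lambda>_::nat. std_normal" by (rule product_prob_space_std_normal)
  show ?thesis
  proof (rule sym, rule P.PiM_eqI)
    interpret L: product_sigma_finite "\<lambda>_::nat. lborel :: real measure" by standard
    show "sets (density (\<Pi>\<^sub>M i\<in>I. lborel) (\<lambda>z. \<Prod>i\<in>I. ennreal (std_normal_density (z i)))) = sets (\<Pi>\<^sub>M i\<in>I. std_normal)"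
      by (simp cong: sets_PiM_cong)
    fix B :: "nat \<Rightarrow> real set" assume "\<And>i. i \<in> I \<Longrightarrow> B i \<in> sets std_normal"
    then have B[measurable]: "\<And>i. i \<in> I \<Longrightarrow> B i \<in> sets borel" by simp
    have BE: "Pi\<^sub>E I B \<in> sets (\<Pi>\<^sub>M i\<in>I. lborel)"
      using B by (intro sets_PiM_I_finite assms) auto
    have "emeasure (density (\<Pi>\<^sub>M i\<in>I. lborel) (\<lambda>z. \<Prod>i\<in>I. ennreal (std_normal_density (z i)))) (Pi\<^sub>E I B)
        = (\<integral>\<^sup>+z. (\<Prod>i\<in>I. ennreal (std_normal_density (z i))) * indicator (Pi\<^sub>E I B) z \<partial>(\<Pi>\<^sub>M i\<in>I. lborel))"
      using BE by (subst emeasure_density) auto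
    also have "\<dots> = (\<integral>\<^sup>+z. (\<Prod>i\<in>I. ennreal (std_normal_density (z i)) * indicator (B i) (z i)) \<partial>(\<Pi>\<^sub>M i\<in>I. lborel))"
    proof (rule nn_integral_cong)
      fix z :: "nat \<Rightarrow> real" assume "z \<in> space (\<Pi>\<^sub>M i\<in>I. lborel)"
      then have "indicator (Pi\<^sub>E I B) z = (\<Prod>i\<in>I. indicator (B i) (z i) :: ennreal)"
        using assms by (auto simp: indicator_def space_PiM PiE_iff split: if_splits)
      then show "(\<Prod>i\<in>I. ennreal (std_normal_density (z i))) * indicator (Pi\<^sub>E I B) z
          = (\<Prod>i\<in>I. ennreal (std_normal_density (z i)) * indicator (B i) (z i))"
        by (simp add: prod.distrib)
    qed
    also have "\<dots> = (\<Prod>i\<in>I. \<integral>\<^sup>+x. ennreal (std_normal_density x) * indicator (B i) x \<partial>lborel)"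
      by (rule L.product_nn_integral_prod) (use assms in auto)
    also have "\<dots> = (\<Prod>i\<in>I. emeasure std_normal (B i))"
      by (intro prod.cong refl) (simp add: emeasure_density)
    finally show "emeasure (density (\<Pi>\<^sub>M i\<in>I. lborel) (\<lambda>z. \<Prod>i\<in>I. ennreal (std_normal_density (z i)))) (Pi\<^sub>E I B)
        = (\<Prod>i\<in>I. emeasure std_normal (B i))" .
  qed fact
qed

lemma std_normal_vec_density_in_frame:
  fixes v :: "nat \<Rightarrow> real ^ 'n"
  assumes "orthonormal_frame v"
  shows "std_normal_vec_density (\<Sum>i = 1..CARD('n). z i *\<^sub>R v i)
    = (\<Prod>i = 1..CARD('n). std_normal_density (z i))"
proof -
  have "(\<Prod>i = 1..CARD('n). std_normal_density (z i))
      = (\<Prod>i = 1..CARD('n). exp (- (z i)\<^sup>2 / 2)) / sqrt (2 * pi) ^ CARD('n)"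
    by (simp add: std_normal_density_def prod_dividef)
  also have "(\<Prod>i = 1..CARD('n). exp (- (z i)\<^sup>2 / 2)) = exp (- (\<Sum>i = 1..CARD('n). z i * z i) / 2)"
    by (simp add: exp_sum sum_negf[symmetric] sum_divide_distrib power2_eq_square)
  finally show ?thesis
    unfolding std_normal_vec_density_def orthonormal_frame_inner_sum[OF assms] real_sqrt_power
    by (rule sym)
qed

text \<open>
  The coordinates of a standard normal vector in an orthonormal frame are independent standard
  normal variables: the map from coordinates to vectors preserves Lebesgue measure, and the density
  depends only on the norm.
\<close>

theorem nn_integral_std_normal_vec_in_frame:
  fixes X :: "'w \<Rightarrow> real ^ 'n" and v :: "nat \<Rightarrow> real ^ 'n"
  assumes X: "distributed M lborel X (\<lambda>x. ennreal (std_normal_vec_density x))"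
    and v: "orthonormal_frame v" and g[measurable]: "g \<in> borel_measurable borel"
  shows "(\<integral>\<^sup>+\<omega>. g (X \<omega>) \<partial>M)
    = (\<integral>\<^sup>+z. g (\<Sum>i = 1..CARD('n). z i *\<^sub>R v i) \<partial>(\<Pi>\<^sub>M i\<in>{1..CARD('n)}. std_normal))"
proof -
  obtain Q :: "real ^ 'n ^ 'n" and e where Q: "orthogonal_matrix Q" "bij_betw e UNIV {1..CARD('n)}"
    "\<And>c. column c Q = v (e c)"
    using orthonormal_frame_matrix[OF v] by blast
  let ?I = "{1..CARD('n)}"
  let ?L = "\<Pi>\<^sub>M i\<in>?I. (lborel :: real measure)"
  let ?T = "\<lambda>z. \<Sum>i\<in>?I. z i *\<^sub>R v i"
  have mem: "e c \<in> ?I" for c using Q(2) by (auto simp: bij_betw_def)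
  have T: "Q *v (\<chi> c. z (e c)) = ?T z" for z
    by (simp add: matrix_mult_sum Q(3) scalar_mult_eq_scaleR
        sum.reindex_bij_betw[OF Q(2), of "\<lambda>i. z i *\<^sub>R v i"])
  have coord: "(\<lambda>z. z (e c)) \<in> borel_measurable ?L" for c
    using measurable_component_singleton[OF mem, where M = "\<lambda>_. lborel :: real measure"] by simp
  have "(\<lambda>z. (\<chi> c. z (e c)) :: real ^ 'n) \<in> borel_measurable ?L"
    using coord by (subst borel_measurable_euclidean_space) (auto simp: Basis_vec_def inner_axis)
  note [measurable] = this
  have [measurable]: "(*v) Q \<in> borel_measurable borel"
    by (intro borel_measurable_continuous_onI linear_continuous_on linear_conv_bounded_linear[THEN iffD1]) simp
  have "orthogonal_transformation ((*v) Q)"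
    using Q(1) by (simp add: orthogonal_transformation_matrix)
  from lborel_distr_orthogonal_transformation[OF this]
  have "lborel = distr lborel borel ((*v) Q)" by simp
  also have "\<dots> = distr (distr ?L borel (\<lambda>z. \<chi> c. z (e c))) borel ((*v) Q)"
    by (subst lborel_vec_eq_distr_PiM[OF Q(2)]) rule
  also have "\<dots> = distr ?L borel ?T"
    by (subst distr_distr) (auto simp: o_def T simp del: One_nat_def)
  finally have lborel: "lborel = distr ?L borel ?T" .
  have [measurable]: "?T \<in> borel_measurable ?L" 
    by (intro borel_measurable_sum borel_measurable_scaleR) auto
  have [measurable]: "std_normal_vec_density \<in> borel_measurable (borel :: (real ^ 'n) measure)"
    unfolding std_normal_vec_density_def by measurable
  have "(\<integral>\<^sup>+\<omega>. g (X \<omega>) \<partial>M) = (\<integral>\<^sup>+x. ennreal (std_normal_vec_density x) * g x \<partial>lborel)"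
    by (rule distributed_nn_integral[OF X, symmetric]) simp
  also have "\<dots> = (\<integral>\<^sup>+z. ennreal (std_normal_vec_density (?T z)) * g (?T z) \<partial>?L)"
    by (subst lborel, subst nn_integral_distr) (auto simp del: One_nat_def)
  also have "\<dots> = (\<integral>\<^sup>+z. (\<Prod>i\<in>?I. ennreal (std_normal_density (z i))) * g (?T z) \<partial>?L)"
    by (simp add: std_normal_vec_density_in_frame[OF v] prod_ennreal del: One_nat_def)
  also have "\<dots> = (\<integral>\<^sup>+z. g (?T z) \<partial>(\<Pi>\<^sub>M i\<in>?I. std_normal))"
    by (subst PiM_std_normal_eq_density, simp, subst nn_integral_density) (auto simp del: One_nat_def)
  finally show ?thesis .
qed

section \<open>Weighted moments and exponential moments\<close>

lemma fact_double_eq_odd_double_fact: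
  "fact (2 * j) = 2 ^ j * fact j * real (odd_double_fact j)"
  by (induction j) (simp_all add: odd_double_fact_def field_simps)

text \<open>
  The weight \<open>exp (- c * x\<^sup>2)\<close> turns the standard normal density into \<open>s\<close> times the centred normal density
  with variance \<open>s\<^sup>2 = 1 / (1 + 2 * c)\<close>, whose even moments are known.
\<close>

lemma std_normal_weighted_even_moment:
  fixes c :: real
  assumes c: "c > - 1 / 2"
  shows "(\<integral>\<^sup>+x. ennreal (exp (- c * x\<^sup>2) * (x\<^sup>2) ^ j) \<partial>std_normal)
    = ennreal (real (odd_double_fact j) / (sqrt (1 + 2 * c) * (1 + 2 * c) ^ j))"
proof -
  define s where "s = 1 / sqrt (1 + 2 * c)"
  have pos: "1 + 2 * c > 0" using c by simp
  then have s: "s > 0" "s\<^sup>2 = 1 / (1 + 2 * c)"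
    by (simp_all add: s_def power_divide)
  have dens: "std_normal_density x * (exp (- c * x\<^sup>2) * (x\<^sup>2) ^ j)
      = s * (normal_density 0 s x * (x - 0) ^ (2 * j))" for x
  proof -
    have "- x\<^sup>2 / 2 + - c * x\<^sup>2 = - (x - 0)\<^sup>2 / (2 * s\<^sup>2)"
      by (simp add: s(2) field_simps)
    then have "exp (- x\<^sup>2 / 2) * exp (- c * x\<^sup>2) = exp (- (x - 0)\<^sup>2 / (2 * s\<^sup>2))"
      by (simp only: exp_add[symmetric])
    moreover have "1 / sqrt (2 * pi) = s / sqrt (2 * pi * s\<^sup>2)"
      using s(1) by (simp add: real_sqrt_mult)
    ultimately show ?thesis
      unfolding std_normal_density_def normal_density_def power_mult
      by (simp only: mult.assoc[symmetric] times_divide_eq_left times_divide_eq_right mult_1_left diff_zero)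
         (simp add: field_simps)
  qed
  have "has_bochner_integral lborel (\<lambda>x. s * (normal_density 0 s x * (x - 0) ^ (2 * j)))
      (s * (fact (2 * j) / ((2 / s\<^sup>2) ^ j * fact j)))"
    by (intro has_bochner_integral_mult_right normal_moment_even s)
  then have "(\<integral>\<^sup>+x. ennreal (s * (normal_density 0 s x * (x - 0) ^ (2 * j))) \<partial>lborel)
      = ennreal (s * (fact (2 * j) / ((2 / s\<^sup>2) ^ j * fact j)))"
    using s(1) by (subst nn_integral_eq_integral) (auto simp: has_bochner_integral_iff power_mult)
  also have "s * (fact (2 * j) / ((2 / s\<^sup>2) ^ j * fact j))
      = real (odd_double_fact j) / (sqrt (1 + 2 * c) * (1 + 2 * c) ^ j)"
  proof -
    have "(2 / s\<^sup>2) ^ j = 2 ^ j * (1 + 2 * c) ^ j"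
      by (simp add: s(2) power_mult_distrib[symmetric])
    then show ?thesis
      by (simp add: fact_double_eq_odd_double_fact s_def)
  qed
  finally have "(\<integral>\<^sup>+x. ennreal (std_normal_density x * (exp (- c * x\<^sup>2) * (x\<^sup>2) ^ j)) \<partial>lborel)
      = ennreal (real (odd_double_fact j) / (sqrt (1 + 2 * c) * (1 + 2 * c) ^ j))"
    by (simp only: dens)
  then show ?thesis
    by (subst nn_integral_density) (auto simp: ennreal_mult'[symmetric])
qed

text \<open>
  On \<open>[0, 1)\<close> this is monotonicity of \<open>(1 - x) * exp x\<close>, obtained from \<open>1 + z \<le> exp z\<close>. For negative \<open>y\<close>
  one compares with \<open>- y\<close>. In terms of logarithms: all coefficients of \<open>- y - ln (1 - y)\<close> as a power
  series in \<open>y\<close> are nonnegative, so its value at \<open>y\<close> is at most that at \<open>\<bar>y\<bar>\<close>, hence at most that at \<open>x\<close>.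
\<close>

lemma one_minus_mult_exp_antimono:
  fixes x y :: real
  assumes "\<bar>y\<bar> \<le> x" "x < 1"
  shows "(1 - x) * exp x \<le> (1 - y) * exp y"
proof -
  have *: "(1 - x) * exp x \<le> (1 - u) * exp u" if u: "0 \<le> u" "u \<le> x" for u
  proof -
    have "1 - x \<le> (1 - u) * (1 + (u - x))"
      using mult_nonneg_nonneg[of u "x - u"] u by (simp add: algebra_simps)
    also have "\<dots> \<le> (1 - u) * exp (u - x)"
      using u assms(2) by (intro mult_left_mono exp_ge_add_one_self) auto
    finally have "(1 - x) * exp x \<le> (1 - u) * exp (u - x) * exp x"
      by (intro mult_right_mono) auto
    then show ?thesis by (simp add: exp_diff)
  qed
  show ?thesis
  proof (cases "y \<ge> 0")
    case True
    then show ?thesis using *[of y] assms by simp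
  next
    case False
    define u where "u = - y"
    have u: "0 \<le> u" "u \<le> x" using False assms by (auto simp: u_def)
    let ?D = "\<lambda>u::real. (1 + u) * exp (- u) - (1 - u) * exp u"
    have "?D 0 \<le> ?D u"
    proof (rule DERIV_nonneg_imp_nondecreasing[OF u(1)])
      fix z :: real assume z: "0 \<le> z" "z \<le> u"
      have "(?D has_real_derivative z * (exp z - exp (- z))) (at z)"
        by (auto intro!: derivative_eq_intros simp: algebra_simps)
      moreover have "z * (exp z - exp (- z)) \<ge> 0"
        using z by simp
      ultimately show "\<exists>D. (?D has_real_derivative D) (at z) \<and> 0 \<le> D" by blast
    qed
    then have "(1 - u) * exp u \<le> (1 - y) * exp y"
      by (simp add: u_def)
    with *[OF u] show ?thesis by simp
  qed
qed

text \<open>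
  The exponential moment is \<open>1 / sqrt ((1 - q) * exp q)\<close> with \<open>q = 2 * th * l\<close>, so among all \<open>l\<close> with
  \<open>\<bar>l\<bar> \<le> a\<close> it is largest at \<open>l = a\<close>. Vanishing \<open>l\<close> is kept apart because such terms must not
  contribute to the number of degrees of freedom.
\<close>

lemma nn_integral_exp_centred_square_le:
  fixes th a l :: real
  assumes th: "th \<ge> 0" "2 * th * a < 1" and l: "\<bar>l\<bar> \<le> a"
  shows "(\<integral>\<^sup>+x. ennreal (exp (th * (l * (x\<^sup>2 - 1)))) \<partial>std_normal)
    \<le> ennreal (if l = 0 then 1 else exp (- th * a) / sqrt (1 - 2 * th * a))"
proof (cases "l = 0")
  case True
  interpret prob_space std_normal by (rule prob_space_normal_density) simp
  show ?thesis using True emeasure_space_1 by simp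
next
  case False
  have abs: "\<bar>2 * th * l\<bar> \<le> 2 * th * a"
    using l th(1) by (simp add: abs_mult mult_left_mono)
  then have lt: "2 * th * l < 1" using th(2) by linarith
  have "(\<integral>\<^sup>+x. ennreal (exp (th * (l * (x\<^sup>2 - 1)))) \<partial>std_normal)
      = (\<integral>\<^sup>+x. ennreal (exp (- th * l)) * ennreal (exp (- (- th * l) * x\<^sup>2) * (x\<^sup>2) ^ 0) \<partial>std_normal)"
    by (simp add: ennreal_mult'[symmetric] exp_add[symmetric] algebra_simps)
  also have "\<dots> = ennreal (exp (- th * l)) * ennreal (1 / sqrt (1 - 2 * th * l))"
    using lt by (subst nn_integral_cmult, simp, subst std_normal_weighted_even_moment)
      (auto simp: odd_double_fact_def mult.assoc)
  also have "\<dots> = ennreal (exp (- th * l) / sqrt (1 - 2 * th * l))"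
    using lt by (simp add: ennreal_mult'[symmetric])
  also have "\<dots> \<le> ennreal (exp (- th * a) / sqrt (1 - 2 * th * a))"
  proof (rule ennreal_leI)
    have eq: "exp (- th * q) / sqrt (1 - 2 * th * q) = 1 / sqrt ((1 - 2 * th * q) * exp (2 * th * q))" for q
    proof -
      have "sqrt (exp (2 * th * q)) = exp (th * q)"
        using exp_double[of "th * q"] by (simp add: mult.assoc)
      then show ?thesis by (simp add: real_sqrt_mult exp_minus divide_inverse mult.commute)
    qed
    have "(1 - 2 * th * a) * exp (2 * th * a) \<le> (1 - 2 * th * l) * exp (2 * th * l)"
      by (rule one_minus_mult_exp_antimono[OF abs th(2)])
    moreover have "(1 - 2 * th * a) * exp (2 * th * a) > 0"
      using th(2) by simp
    ultimately show "exp (- th * l) / sqrt (1 - 2 * th * l) \<le> exp (- th * a) / sqrt (1 - 2 * th * a)"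
      unfolding eq by (intro divide_left_mono mult_pos_pos) auto
  qed
  finally show ?thesis using False by simp
qed

section \<open>Chernoff bound for the remaining eigenvalues\<close>

text \<open>
  The bound is the Chernoff bound of a centred chi-square variable with \<open>2 * p\<close> degrees of freedom,
  scaled by \<open>a\<close>. The optimal exponent \<open>th\<close> is the one with \<open>1 - 2 * th * a = 1 / w\<close>, where
  \<open>w = 1 + s / (2 * p * a)\<close>.
\<close>

lemma chernoff_centred_squares:
  fixes lam :: "nat \<Rightarrow> real" and a s :: real
  assumes J: "finite J" and a: "a > 0" "\<And>i. i \<in> J \<Longrightarrow> \<bar>lam i\<bar> \<le> a"
    and m: "card {i \<in> J. lam i \<noteq> 0} = 2 * p" "p > 0" and s: "s \<ge> 0"
  shows "(\<integral>\<^sup>+z. indicator {z. (\<Sum>i\<in>J. lam i * ((z i)\<^sup>2 - 1)) > s} z \<partial>(\<Pi>\<^sub>M i\<in>J. std_normal))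
    \<le> ennreal (exp (- s / (2 * a)) * (1 + s / (2 * real p * a)) ^ p)"
proof -
  interpret product_prob_space "\<lambda>_::nat. std_normal" by (rule product_prob_space_std_normal)
  define w where "w = 1 + s / (2 * real p * a)"
  define th where "th = (1 - 1 / w) / (2 * a)"
  define C where "C = exp (- th * a) / sqrt (1 - 2 * th * a)"
  have w: "w \<ge> 1" using s a m(2) by (simp add: w_def)
  have th: "th \<ge> 0" using w a by (simp add: th_def)
  have tha: "1 - 2 * th * a = 1 / w" using a(1) w by (simp add: th_def field_simps)
  have tha1: "2 * th * a < 1"
  proof -
    have "1 / w > 0" using w by simp
    with tha show ?thesis by linarith
  qed
  have C0: "C \<ge> 0" using tha1 by (simp add: C_def)
  have "(\<integral>\<^sup>+z. indicator {z. (\<Sum>i\<in>J. lam i * ((z i)\<^sup>2 - 1)) > s} z \<partial>(\<Pi>\<^sub>M i\<in>J. std_normal))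
      \<le> (\<integral>\<^sup>+z. ennreal (exp (- th * s)) * (\<Prod>i\<in>J. ennreal (exp (th * (lam i * ((z i)\<^sup>2 - 1))))) \<partial>(\<Pi>\<^sub>M i\<in>J. std_normal))"
  proof (rule nn_integral_mono)
    fix z :: "nat \<Rightarrow> real"
    let ?V = "\<Sum>i\<in>J. lam i * ((z i)\<^sup>2 - 1)"
    have "(\<Prod>i\<in>J. ennreal (exp (th * (lam i * ((z i)\<^sup>2 - 1))))) = ennreal (exp (th * ?V))"
      using J by (simp add: prod_ennreal exp_sum sum_distrib_left)
    then have "ennreal (exp (- th * s)) * (\<Prod>i\<in>J. ennreal (exp (th * (lam i * ((z i)\<^sup>2 - 1)))))
        = ennreal (exp (th * (?V - s)))"
      by (simp add: ennreal_mult'[symmetric] exp_add[symmetric] algebra_simps)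
    moreover have "ennreal (exp (th * (?V - s))) \<ge> 1" if "?V > s"
      using that th by simp
    ultimately show "indicator {z. (\<Sum>i\<in>J. lam i * ((z i)\<^sup>2 - 1)) > s} z
        \<le> ennreal (exp (- th * s)) * (\<Prod>i\<in>J. ennreal (exp (th * (lam i * ((z i)\<^sup>2 - 1)))))"
      by (auto simp: indicator_def)
  qed
  also have "\<dots> = ennreal (exp (- th * s)) * (\<Prod>i\<in>J. \<integral>\<^sup>+x. ennreal (exp (th * (lam i * (x\<^sup>2 - 1)))) \<partial>std_normal)"
    using J by (subst nn_integral_cmult, simp, subst product_nn_integral_prod) auto
  also have "\<dots> \<le> ennreal (exp (- th * s)) * (\<Prod>i\<in>J. ennreal (if lam i = 0 then 1 else C))"
    unfolding C_def
    by (intro mult_left_mono prod_mono_ennreal nn_integral_exp_centred_square_le th tha1 a) auto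
  also have "(\<Prod>i\<in>J. ennreal (if lam i = 0 then 1 else C)) = ennreal (C ^ (2 * p))"
  proof -
    have "(\<Prod>i\<in>J. if lam i = 0 then 1 else C) = (\<Prod>i\<in>{i \<in> J. lam i \<noteq> 0}. C)"
      using J by (subst prod.inter_filter) (auto intro!: prod.cong)
    with C0 m(1) show ?thesis by (subst prod_ennreal) auto
  qed
  also have "ennreal (exp (- th * s)) * ennreal (C ^ (2 * p)) = ennreal (exp (- th * s) * C ^ (2 * p))"
    by (simp add: ennreal_mult')
  also have "exp (- th * s) * C ^ (2 * p) = exp (- s / (2 * a)) * w ^ p"
  proof -
    have "C\<^sup>2 = exp (- 2 * th * a) * w"
      unfolding C_def tha using w by (simp add: power_divide exp_double[symmetric] mult.assoc)
    then have "C ^ (2 * p) = exp (real p * (- 2 * th * a)) * w ^ p"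
      unfolding power_mult by (simp only: power_mult_distrib exp_of_nat_mult)
    moreover have "- th * s + real p * (- 2 * th * a) = - s / (2 * a)"
    proof -
      have sw: "s = 2 * real p * a * (w - 1)" using a m(2) by (simp add: w_def)
      have "2 * a * th * w = w - 1" using a w by (simp add: th_def field_simps)
      moreover have "s + 2 * real p * a = 2 * real p * a * w" unfolding sw by algebra
      ultimately have "th * (s + 2 * real p * a) = real p * (w - 1)" by algebra
      moreover have "s / (2 * a) = real p * (w - 1)" unfolding sw using a by simp
      ultimately show ?thesis by (simp add: algebra_simps)
    qed
    ultimately show ?thesis
      by (metis exp_add mult.assoc)
  qed
  finally show ?thesis by (simp add: w_def)
qed

section \<open>Multinomial expansion\<close>

lemma index_tuples_0: "index_tuples 0 l = (if l = 0 then {\<lambda>_. undefined} else {})"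
  by (auto simp: index_tuples_def)

text \<open>
  A tuple of length \<open>k + 1\<close> is split into its last entry \<open>q\<close> and the tuple of the others; resetting
  entry \<open>k + 1\<close> to \<open>undefined\<close> keeps the shorter tuple extensional.
\<close>

lemma sum_index_tuples_Suc:
  fixes F :: "(nat \<Rightarrow> nat) \<Rightarrow> 'a::comm_monoid_add"
  shows "(\<Sum>j\<in>index_tuples (Suc k) l. F j)
    = (\<Sum>q\<le>l. \<Sum>j\<in>index_tuples k (l - q). F (j(Suc k := q)))"
proof -
  have ivl: "{1..Suc k} = insert (Suc k) {1..k}" by auto
  have "(\<Sum>q\<le>l. \<Sum>j\<in>index_tuples k (l - q). F (j(Suc k := q)))
      = (\<Sum>(q, j)\<in>(SIGMA q:{..l}. index_tuples k (l - q)). F (j(Suc k := q)))"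
    by (rule sum.Sigma) (auto simp: finite_index_tuples)
  also have "\<dots> = (\<Sum>j\<in>index_tuples (Suc k) l. F j)"
  proof (rule sum.reindex_bij_witness[where
        i = "\<lambda>j. (j (Suc k), j(Suc k := undefined))" and j = "\<lambda>(q, j). j(Suc k := q)"])
    fix j assume "j \<in> index_tuples (Suc k) l"
    then show "(j (Suc k), j(Suc k := undefined)) \<in> (SIGMA q:{..l}. index_tuples k (l - q))"
      by (auto simp: index_tuples_def ivl PiE_iff extensional_def)
  next
    fix x assume "x \<in> (SIGMA q:{..l}. index_tuples k (l - q))"
    then show "(case x of (q, j) \<Rightarrow> j(Suc k := q)) \<in> index_tuples (Suc k) l"
      by (auto simp: index_tuples_def ivl PiE_iff extensional_def)
  qed (auto simp: index_tuples_def PiE_iff extensional_def fun_eq_iff split: if_splits)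
  finally show ?thesis by simp
qed

lemma multinomial_index_tuples:
  fixes x :: "nat \<Rightarrow> real"
  shows "(\<Sum>i = 1..k. x i) ^ l / fact l
    = (\<Sum>j\<in>index_tuples k l. \<Prod>i = 1..k. x i ^ j i / fact (j i))"
proof (induction k arbitrary: l)
  case 0
  then show ?case by (simp add: index_tuples_0 power_0_left)
next
  case (Suc k)
  have "(\<Sum>i = 1..Suc k. x i) ^ l / fact l
      = (\<Sum>q\<le>l. x (Suc k) ^ q / fact q * ((\<Sum>i = 1..k. x i) ^ (l - q) / fact (l - q)))"
    using binomial_ring[of "x (Suc k)" "\<Sum>i = 1..k. x i" l]
    by (simp add: add.commute sum_divide_distrib binomial_fact)
  also have "\<dots> = (\<Sum>q\<le>l. \<Sum>j\<in>index_tuples k (l - q).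
      \<Prod>i = 1..Suc k. x i ^ (j(Suc k := q)) i / fact ((j(Suc k := q)) i))"
    unfolding Suc.IH sum_distrib_left
  proof (intro sum.cong refl)
    fix q and j :: "nat \<Rightarrow> nat"
    have "(\<Prod>i = 1..k. x i ^ (j(Suc k := q)) i / fact ((j(Suc k := q)) i)) = (\<Prod>i = 1..k. x i ^ j i / fact (j i))"
      by (intro prod.cong) auto
    then show "x (Suc k) ^ q / fact q * (\<Prod>i = 1..k. x i ^ j i / fact (j i))
        = (\<Prod>i = 1..Suc k. x i ^ (j(Suc k := q)) i / fact ((j(Suc k := q)) i))"
      by (simp add: mult.commute)
  qed
  also have "\<dots> = (\<Sum>j\<in>index_tuples (Suc k) l. \<Prod>i = 1..Suc k. x i ^ j i / fact (j i))"
    by (rule sum_index_tuples_Suc[symmetric])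
  finally show ?case .
qed


lemma binomial_multinomial_expansion:
  fixes x :: "nat \<Rightarrow> real"
  shows "(u + (\<Sum>i = 1..k. x i)) ^ p
    = (\<Sum>l = 0..p. \<Sum>j\<in>index_tuples k l.
        fact p / fact (p - l) * u ^ (p - l) * (\<Prod>i = 1..k. x i ^ j i / fact (j i)))"
proof -
  have "(u + (\<Sum>i = 1..k. x i)) ^ p
      = (\<Sum>l = 0..p. fact p / fact (p - l) * u ^ (p - l) * ((\<Sum>i = 1..k. x i) ^ l / fact l))"
    using binomial_ring[of "\<Sum>i = 1..k. x i" u p]
    by (simp add: add.commute binomial_fact atLeast0AtMost mult_ac)
  then show ?thesis
    by (simp only: multinomial_index_tuples sum_distrib_left)
qed

section \<open>Averaging over the negative eigenvalues\<close>

lemma ennreal_double_sum: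
  assumes "\<And>l j. 0 \<le> f l j"
  shows "ennreal (\<Sum>l\<in>L. \<Sum>j\<in>T l. f l j) = (\<Sum>l\<in>L. \<Sum>j\<in>T l. ennreal (f l j))"
  using assms by (simp add: sum_ennreal sum_nonneg)

text \<open>
  The random shift \<open>s z\<close> is \<open>c\<close> plus the quadratic form of the \<open>k\<close> negative eigenvalues with sign
  reversed. After binomial and multinomial expansion of the power, every summand is a product over
  \<open>i\<close> of a power of \<open>(z i)\<^sup>2\<close> weighted by \<open>exp (lam i * (z i)\<^sup>2 / (2 * a))\<close>. Its expectation is thus a
  product of weighted moments, which are the factors in \<^const>\<open>tail_coeff\<close>.
\<close>

lemma expected_chernoff_bound:
  fixes lam :: "nat \<Rightarrow> real" and a c :: real
  assumes a: "a > 0" and c: "c \<ge> 0" and neg: "\<And>i. i \<in> {1..k} \<Longrightarrow> lam i < 0"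
    and r: "r = k + 2 * p" "p > 0"
  defines "s \<equiv> \<lambda>z. c - (\<Sum>i = 1..k. lam i * (z i)\<^sup>2)"
  shows "(\<integral>\<^sup>+z. ennreal (exp (- s z / (2 * a)) * (1 + s z / (2 * real p * a)) ^ p) \<partial>(\<Pi>\<^sub>M i\<in>{1..k}. std_normal))
    = ennreal (exp (- c / (2 * a)) *
       (\<Sum>l = 0..p. tail_coeff r k a lam l / fact (p - l) * (1 + c / (2 * real p * a)) ^ (p - l)))"
proof -
  interpret product_prob_space "\<lambda>_::nat. std_normal" by (rule product_prob_space_std_normal)
  let ?I = "{1..k}"
  define u where "u = 1 + c / (2 * real p * a)"
  define d where "d = (\<lambda>i. - lam i / (2 * real p * a))"
  define K where "K = (\<lambda>l. exp (- c / (2 * a)) * (fact p / fact (p - l) * u ^ (p - l)))"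
  define q where "q = (\<lambda>i. - lam i / a + 1)"
  define G where "G = (\<lambda>i j x. d i ^ j / fact j * (exp (- (- lam i / (2 * a)) * x\<^sup>2) * (x\<^sup>2) ^ j))"
  define m where "m = (\<lambda>i j. real (odd_double_fact j) / fact j * phi r k a lam i ^ j)"
  have u: "u \<ge> 0" using a c r(2) by (simp add: u_def)
  have K: "K l \<ge> 0" for l using u by (simp add: K_def)
  have d: "d i \<ge> 0" if "i \<in> ?I" for i
    using neg[OF that] a r(2) by (simp add: d_def divide_nonpos_pos)
  have q: "q i > 0" if "i \<in> ?I" for i
    using neg[OF that] a by (simp add: q_def add_nonneg_pos divide_nonpos_pos)
  have G0: "G i j x \<ge> 0" if "i \<in> ?I" for i j x
    using d[OF that] by (simp add: G_def)
  have phi_eq: "phi r k a lam i = d i / q i" for i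
    by (simp add: phi_def d_def q_def r)
  have m0: "m i j \<ge> 0" if "i \<in> ?I" for i j
    using d[OF that] q[OF that] by (simp add: m_def phi_eq)

  have expand: "exp (- s z / (2 * a)) * (1 + s z / (2 * real p * a)) ^ p
      = (\<Sum>l = 0..p. \<Sum>j\<in>index_tuples k l. K l * (\<Prod>i\<in>?I. G i (j i) (z i)))" for z
  proof -
    have lin: "1 + s z / (2 * real p * a) = u + (\<Sum>i = 1..k. d i * (z i)\<^sup>2)"
      by (simp add: s_def u_def d_def diff_divide_distrib sum_negf sum_divide_distrib)
    have "- s z / (2 * a) = - c / (2 * a) + (\<Sum>i = 1..k. - (- lam i / (2 * a)) * (z i)\<^sup>2)"
      by (simp add: s_def diff_divide_distrib sum_divide_distrib)
    then have ex: "exp (- s z / (2 * a)) = exp (- c / (2 * a)) * (\<Prod>i = 1..k. exp (- (- lam i / (2 * a)) * (z i)\<^sup>2))"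
      by (simp only: exp_add exp_sum[OF finite_atLeastAtMost])
    have "exp (- s z / (2 * a)) * (fact p / fact (p - l) * u ^ (p - l) * (\<Prod>i = 1..k. (d i * (z i)\<^sup>2) ^ j i / fact (j i)))
        = K l * (\<Prod>i\<in>?I. G i (j i) (z i))" for l j
      unfolding ex K_def G_def
      by (simp add: prod.distrib[symmetric] power_mult_distrib mult_ac prod_dividef)
    then show ?thesis
      unfolding lin binomial_multinomial_expansion sum_distrib_left by simp
  qed

  have moment: "(\<integral>\<^sup>+x. ennreal (G i j x) \<partial>std_normal) = ennreal (1 / sqrt (q i) * m i j)"
    if i: "i \<in> ?I" for i j
  proof -
    have q_eq: "1 + 2 * (- lam i / (2 * a)) = q i" using a by (simp add: q_def)
    have "(\<integral>\<^sup>+x. ennreal (G i j x) \<partial>std_normal)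
        = ennreal (d i ^ j / fact j) * (\<integral>\<^sup>+x. ennreal (exp (- (- lam i / (2 * a)) * x\<^sup>2) * (x\<^sup>2) ^ j) \<partial>std_normal)"
      unfolding G_def using d[OF i] by (subst nn_integral_cmult[symmetric]) (auto simp: ennreal_mult'[symmetric])
    also have "\<dots> = ennreal (d i ^ j / fact j) * ennreal (real (odd_double_fact j) / (sqrt (q i) * q i ^ j))"
      using q[OF i] q_eq by (subst std_normal_weighted_even_moment) auto
    also have "\<dots> = ennreal (1 / sqrt (q i) * m i j)"
      using d[OF i] by (subst ennreal_mult'[symmetric]) (auto simp: m_def phi_eq power_divide mult_ac)
    finally show ?thesis .
  qed

  have "(\<integral>\<^sup>+z. ennreal (exp (- s z / (2 * a)) * (1 + s z / (2 * real p * a)) ^ p) \<partial>(\<Pi>\<^sub>M i\<in>?I. std_normal))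
      = (\<integral>\<^sup>+z. (\<Sum>l = 0..p. \<Sum>j\<in>index_tuples k l. ennreal (K l) * (\<Prod>i\<in>?I. ennreal (G i (j i) (z i)))) \<partial>(\<Pi>\<^sub>M i\<in>?I. std_normal))"
  proof (rule nn_integral_cong)
    fix z :: "nat \<Rightarrow> real"
    have "ennreal (\<Sum>l = 0..p. \<Sum>j\<in>index_tuples k l. K l * (\<Prod>i\<in>?I. G i (j i) (z i)))
        = (\<Sum>l = 0..p. \<Sum>j\<in>index_tuples k l. ennreal (K l * (\<Prod>i\<in>?I. G i (j i) (z i))))"
      by (rule ennreal_double_sum) (use K G0 in \<open>auto intro!: mult_nonneg_nonneg prod_nonneg\<close>)
    also have "\<dots> = (\<Sum>l = 0..p. \<Sum>j\<in>index_tuples k l. ennreal (K l) * (\<Prod>i\<in>?I. ennreal (G i (j i) (z i))))"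
      using K G0 by (intro sum.cong refl, subst prod_ennreal) (auto simp: ennreal_mult')
    finally show "ennreal (exp (- s z / (2 * a)) * (1 + s z / (2 * real p * a)) ^ p)
        = (\<Sum>l = 0..p. \<Sum>j\<in>index_tuples k l. ennreal (K l) * (\<Prod>i\<in>?I. ennreal (G i (j i) (z i))))"
      by (simp only: expand)
  qed
  also have "\<dots> = (\<Sum>l = 0..p. \<Sum>j\<in>index_tuples k l. ennreal (K l) * (\<Prod>i\<in>?I. \<integral>\<^sup>+x. ennreal (G i (j i) x) \<partial>std_normal))"
  proof -
    have [measurable]: "(\<lambda>x. ennreal (G i j x)) \<in> borel_measurable borel" for i j
      unfolding G_def by measurable
    have "(\<lambda>z. \<Prod>i\<in>?I. ennreal (G i (j i) (z i))) \<in> borel_measurable (\<Pi>\<^sub>M i\<in>?I. std_normal)" for j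
      by measurable
    moreover have "(\<integral>\<^sup>+z. (\<Prod>i\<in>?I. ennreal (G i (j i) (z i))) \<partial>(\<Pi>\<^sub>M i\<in>?I. std_normal))
        = (\<Prod>i\<in>?I. \<integral>\<^sup>+x. ennreal (G i (j i) x) \<partial>std_normal)" for j
      by (rule product_nn_integral_prod) auto
    ultimately show ?thesis
      by (simp add: nn_integral_sum nn_integral_cmult del: One_nat_def)
  qed
  also have "\<dots> = (\<Sum>l = 0..p. \<Sum>j\<in>index_tuples k l. ennreal (K l * (\<Prod>i\<in>?I. 1 / sqrt (q i) * m i (j i))))"
  proof (intro sum.cong refl)
    fix l j
    have "(\<Prod>i\<in>?I. \<integral>\<^sup>+x. ennreal (G i (j i) x) \<partial>std_normal) = (\<Prod>i\<in>?I. ennreal (1 / sqrt (q i) * m i (j i)))"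
      by (intro prod.cong refl moment)
    also have "\<dots> = ennreal (\<Prod>i\<in>?I. 1 / sqrt (q i) * m i (j i))"
    proof (rule prod_ennreal)
      fix i assume "i \<in> ?I"
      then show "0 \<le> 1 / sqrt (q i) * m i (j i)"
        using m0[of i "j i"] q[of i] by simp
    qed
    finally show "ennreal (K l) * (\<Prod>i\<in>?I. \<integral>\<^sup>+x. ennreal (G i (j i) x) \<partial>std_normal)
        = ennreal (K l * (\<Prod>i\<in>?I. 1 / sqrt (q i) * m i (j i)))"
      using K by (simp only: ennreal_mult')
  qed
  also have "\<dots> = ennreal (\<Sum>l = 0..p. \<Sum>j\<in>index_tuples k l. K l * (\<Prod>i\<in>?I. 1 / sqrt (q i) * m i (j i)))"
  proof -
    have nonneg: "0 \<le> K l * (\<Prod>i\<in>?I. 1 / sqrt (q i) * m i (j i))" for l j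
    proof (intro mult_nonneg_nonneg K prod_nonneg)
      fix i assume "i \<in> ?I"
      then show "0 \<le> 1 / sqrt (q i)" "0 \<le> m i (j i)"
        using m0[of i "j i"] q[of i] by simp_all
    qed
    then show ?thesis by (intro ennreal_double_sum[symmetric])
  qed
  also have "(\<Sum>l = 0..p. \<Sum>j\<in>index_tuples k l. K l * (\<Prod>i\<in>?I. 1 / sqrt (q i) * m i (j i)))
      = exp (- c / (2 * a)) * (\<Sum>l = 0..p. tail_coeff r k a lam l / fact (p - l) * u ^ (p - l))"
    unfolding sum_distrib_left
  proof (rule sum.cong[OF refl])
    fix l
    have "(\<Sum>j\<in>index_tuples k l. K l * (\<Prod>i\<in>?I. 1 / sqrt (q i) * m i (j i)))
        = K l * (1 / (\<Prod>i\<in>?I. sqrt (q i)) * (\<Sum>j\<in>index_tuples k l. \<Prod>i\<in>?I. m i (j i)))"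
      by (simp add: sum_distrib_left prod.distrib prod_dividef sum_divide_distrib)
    also have "\<dots> = exp (- c / (2 * a)) * (tail_coeff r k a lam l / fact (p - l) * u ^ (p - l))"
      by (simp add: K_def tail_coeff_def m_def q_def r mult_ac)
    finally show "(\<Sum>j\<in>index_tuples k l. K l * (\<Prod>i\<in>?I. 1 / sqrt (q i) * m i (j i)))
        = exp (- c / (2 * a)) * (tail_coeff r k a lam l / fact (p - l) * u ^ (p - l))" .
  qed
  finally show ?thesis by (simp only: u_def)
qed

text \<open>
  With the first \<open>k\<close> coordinates \<open>x\<close> fixed, the event says that the centred sum over the others exceeds
  \<open>s x\<close>. Negativity of the first \<open>k\<close> eigenvalues gives \<open>s x \<ge> c \<ge> 0\<close>, so the Chernoff bound applies for
  each \<open>x\<close>, with an exponent that depends on \<open>x\<close>.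
\<close>

lemma centred_squares_tail_bound:
  fixes lam :: "nat \<Rightarrow> real" and a t :: real
  assumes k: "k \<le> n" and neg: "\<And>i. i \<in> {1..k} \<Longrightarrow> lam i < 0"
    and a: "a > 0" "\<And>i. i \<in> {k + 1..n} \<Longrightarrow> \<bar>lam i\<bar> \<le> a"
    and card: "card {i \<in> {k + 1..n}. lam i \<noteq> 0} = 2 * p" "p > 0"
    and r: "r = k + 2 * p"
    and t: "t + (\<Sum>i = 1..k. lam i) \<ge> 0"
  defines "c \<equiv> t + (\<Sum>i = 1..k. lam i)"
  shows "(\<integral>\<^sup>+z. indicator {z. (\<Sum>i = 1..n. lam i * ((z i)\<^sup>2 - 1)) > t} z \<partial>(\<Pi>\<^sub>M i\<in>{1..n}. std_normal))
    \<le> ennreal (exp (- c / (2 * a)) *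
       (\<Sum>l = 0..p. tail_coeff r k a lam l / fact (p - l) * (1 + c / (2 * real p * a)) ^ (p - l)))"
proof -
  interpret product_prob_space "\<lambda>_::nat. std_normal" by (rule product_prob_space_std_normal)
  let ?I = "{1..k}" and ?J = "{k + 1..n}"
  define s where "s = (\<lambda>x. c - (\<Sum>i\<in>?I. lam i * (x i)\<^sup>2))"
  have un: "{1..n} = ?I \<union> ?J" and disj: "?I \<inter> ?J = {}" using k by auto
  have s0: "s x \<ge> 0" for x
  proof -
    have "(\<Sum>i\<in>?I. lam i * (x i)\<^sup>2) \<le> 0"
      using neg by (intro sum_nonpos) (simp add: mult_nonpos_nonneg less_imp_le)
    with t show ?thesis by (simp add: s_def c_def)
  qed
  have split: "(\<Sum>i = 1..n. lam i * ((merge ?I ?J (x, y) i)\<^sup>2 - 1)) > t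
      \<longleftrightarrow> (\<Sum>i\<in>?J. lam i * ((y i)\<^sup>2 - 1)) > s x" for x y
  proof -
    have "(\<Sum>i = 1..n. lam i * ((merge ?I ?J (x, y) i)\<^sup>2 - 1))
        = (\<Sum>i\<in>?I. lam i * ((merge ?I ?J (x, y) i)\<^sup>2 - 1)) + (\<Sum>i\<in>?J. lam i * ((merge ?I ?J (x, y) i)\<^sup>2 - 1))"
      unfolding un by (rule sum.union_disjoint) (use disj in auto)
    also have "(\<Sum>i\<in>?I. lam i * ((merge ?I ?J (x, y) i)\<^sup>2 - 1)) = (\<Sum>i\<in>?I. lam i * (x i)\<^sup>2) - (\<Sum>i\<in>?I. lam i)"
      by (subst sum_subtractf[symmetric], rule sum.cong) (auto simp: merge_def right_diff_distrib)
    also have "(\<Sum>i\<in>?J. lam i * ((merge ?I ?J (x, y) i)\<^sup>2 - 1)) = (\<Sum>i\<in>?J. lam i * ((y i)\<^sup>2 - 1))"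
      by (rule sum.cong) (auto simp: merge_def)
    finally show ?thesis by (auto simp: s_def c_def)
  qed
  have meas: "(\<lambda>z. indicator {z. (\<Sum>i = 1..n. lam i * ((z i)\<^sup>2 - 1)) > t} z :: ennreal)
      \<in> borel_measurable (\<Pi>\<^sub>M i\<in>?I \<union> ?J. std_normal)"
    unfolding un[symmetric] indicator_def by measurable
  have "(\<integral>\<^sup>+z. indicator {z. (\<Sum>i = 1..n. lam i * ((z i)\<^sup>2 - 1)) > t} z \<partial>(\<Pi>\<^sub>M i\<in>{1..n}. std_normal))
      = (\<integral>\<^sup>+x. (\<integral>\<^sup>+y. indicator {z. (\<Sum>i = 1..n. lam i * ((z i)\<^sup>2 - 1)) > t} (merge ?I ?J (x, y))
          \<partial>(\<Pi>\<^sub>M i\<in>?J. std_normal)) \<partial>(\<Pi>\<^sub>M i\<in>?I. std_normal))"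
    using product_nn_integral_fold[OF disj _ _ meas] unfolding un by simp
  also have "\<dots> = (\<integral>\<^sup>+x. (\<integral>\<^sup>+y. indicator {y. (\<Sum>i\<in>?J. lam i * ((y i)\<^sup>2 - 1)) > s x} y
          \<partial>(\<Pi>\<^sub>M i\<in>?J. std_normal)) \<partial>(\<Pi>\<^sub>M i\<in>?I. std_normal))"
    by (simp only: indicator_def mem_Collect_eq split)
  also have "\<dots> \<le> (\<integral>\<^sup>+x. ennreal (exp (- s x / (2 * a)) * (1 + s x / (2 * real p * a)) ^ p) \<partial>(\<Pi>\<^sub>M i\<in>?I. std_normal))"
    by (intro nn_integral_mono chernoff_centred_squares a card s0) auto
  also have "\<dots> = ennreal (exp (- c / (2 * a)) *
       (\<Sum>l = 0..p. tail_coeff r k a lam l / fact (p - l) * (1 + c / (2 * real p * a)) ^ (p - l)))"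
    unfolding s_def by (rule expected_chernoff_bound) (use a neg r card t in \<open>auto simp: c_def\<close>)
  finally show ?thesis .
qed

lemma tail_coeff_nonneg:
  assumes "a > 0" "\<And>i. i \<in> {1..k} \<Longrightarrow> lam i < 0" "k < r"
  shows "tail_coeff r k a lam l \<ge> 0"
proof -
  have "phi r k a lam i \<ge> 0" if "i \<in> {1..k}" for i
    unfolding phi_def using assms(1,3) assms(2)[OF that]
    by (intro divide_nonneg_nonneg mult_nonneg_nonneg add_nonneg_nonneg) auto
  moreover have "lam i < a" if "i \<in> {1..k}" for i
    using assms(1) assms(2)[OF that] by simp
  ultimately show ?thesis
    unfolding tail_coeff_def using assms(1,2)
    by (intro mult_nonneg_nonneg divide_nonneg_nonneg sum_nonneg prod_nonneg)
       (auto intro!: add_nonneg_nonneg divide_nonpos_pos less_imp_le)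
qed

section \<open>The tail bound\<close>

theorem proposition6:
  fixes A :: "real ^ 'n ^ 'n"
    and lam :: "nat \<Rightarrow> real"
    and k :: nat
    and a b t :: real
    and M :: "'w measure"
    and X :: "'w \<Rightarrow> real ^ 'n"
  assumes sym: "transpose A = A"
    and rank: "rank A \<ge> 3"
    and eigs: "eigenvalue_family A lam"
    and k: "1 \<le> k" "k \<le> CARD('n) - 1"
    and sorted: "\<And>i j. 1 \<le> i \<Longrightarrow> i \<le> j \<Longrightarrow> j \<le> k \<Longrightarrow> lam i \<le> lam j"
    and neg: "lam k < 0"
    and smallest: "\<And>j. k < j \<Longrightarrow> j \<le> CARD('n) \<Longrightarrow> lam k \<le> lam j"
    and parity: "even (int (rank A) - int k)"
    and a: "a = Max ((\<lambda>i. \<bar>lam i\<bar>) ` {k + 1..CARD('n)})"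
    and b: "b = (\<Sum>i = 1..k. lam i)"
    and a_pos: "a > 0"
    and M: "prob_space M"
    and X: "distributed M lborel X (\<lambda>x. ennreal (std_normal_vec_density x))"
    and t: "t > 0" "t + b \<ge> 0"
  shows "\<P>(\<omega> in M. X \<omega> \<bullet> (A *v X \<omega>) - trace A > t)
    \<le> exp (- (t + b) / (2 * a)) *
       (\<Sum>l = 0..(rank A - k) div 2.
          tail_coeff (rank A) k a lam l / fact ((rank A - k) div 2 - l) *
          (1 + (t + b) / ((real (rank A) - real k) * a)) ^ ((rank A - k) div 2 - l))"
proof -
  let ?n = "CARD('n)"
  interpret prob_space M by (rule M)
  obtain v where "eigenframe A v lam"
    using eigenvalue_family_eigenframe[OF sym eigs] by blast
  then interpret eigenframe A v lam .
  have kn: "k < ?n" using k by (simp add: Suc_le_eq[symmetric])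
  have lneg: "lam i < 0" if "i \<in> {1..k}" for i
    using sorted[of i k] neg that by auto
  have la: "\<bar>lam i\<bar> \<le> a" if "i \<in> {k + 1..?n}" for i
    unfolding a using that by (intro Max_ge) auto
  let ?J = "{i \<in> {k + 1..?n}. lam i \<noteq> 0}"
  have "{i \<in> {1..?n}. lam i \<noteq> 0} = {1..k} \<union> ?J"
    using kn lneg by force
  then have rank_eq: "rank A = k + card ?J"
    unfolding rank_eq_card by (simp add: card_Un_disjoint disjoint_iff)
  have "a \<in> (\<lambda>i. \<bar>lam i\<bar>) ` {k + 1..?n}"
    unfolding a using kn by (intro Max_in) auto
  then have "?J \<noteq> {}" using a_pos by fastforce
  then have card_pos: "card ?J > 0" by (simp add: card_gt_0_iff)
  \<comment> \<open>The truncating subtraction and the halving are exact: the rank exceeds \<open>k\<close> by the even number \<open>card ?J\<close>.\<close>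
  define p where "p = (rank A - k) div 2"
  have p: "card ?J = 2 * p" "p > 0"
    using parity card_pos unfolding p_def rank_eq by (auto elim!: evenE)
  then have r: "rank A = k + 2 * p" using rank_eq by simp
  let ?B = "exp (- (t + b) / (2 * a)) *
       (\<Sum>l = 0..p. tail_coeff (rank A) k a lam l / fact (p - l) * (1 + (t + b) / (2 * real p * a)) ^ (p - l))"
  have "(t + b) / (2 * real p * a) \<ge> 0"
    using a_pos t(2) by simp
  then have B0: "?B \<ge> 0"
    using a_pos r p(2) lneg
    by (intro mult_nonneg_nonneg sum_nonneg divide_nonneg_nonneg zero_le_power tail_coeff_nonneg) auto
  let ?E = "{x. x \<bullet> (A *v x) - trace A > t}"
  have [measurable]: "(*v) A \<in> borel_measurable borel"
    by (intro borel_measurable_continuous_onI linear_continuous_on linear_conv_bounded_linear[THEN iffD1]) simp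
  have E[measurable]: "?E \<in> sets borel" by measurable
  have Xm[measurable]: "X \<in> borel_measurable M"
    using distributed_measurable[OF X] by simp
  have "emeasure M (X -` ?E \<inter> space M) = (\<integral>\<^sup>+\<omega>. indicator (X -` ?E \<inter> space M) \<omega> \<partial>M)"
    by (rule nn_integral_indicator[symmetric]) (rule measurable_sets[OF Xm E])
  also have "\<dots> = (\<integral>\<^sup>+\<omega>. indicator ?E (X \<omega>) \<partial>M)"
    by (rule nn_integral_cong) (auto simp: indicator_def)
  also have "\<dots> = (\<integral>\<^sup>+z. indicator ?E (\<Sum>i = 1..?n. z i *\<^sub>R v i) \<partial>(\<Pi>\<^sub>M i\<in>{1..?n}. std_normal))"
    by (rule nn_integral_std_normal_vec_in_frame[OF X frame]) simp
  also have "\<dots> = (\<integral>\<^sup>+z. indicator {z. (\<Sum>i = 1..?n. lam i * ((z i)\<^sup>2 - 1)) > t} z \<partial>(\<Pi>\<^sub>M i\<in>{1..?n}. std_normal))"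
    by (simp only: indicator_def mem_Collect_eq quadratic_form_in_frame trace_eq_sum
        sum_subtractf[symmetric] right_diff_distrib mult_1_right)
  also have "\<dots> \<le> ennreal ?B"
    unfolding b by (rule centred_squares_tail_bound)
      (use kn lneg a_pos la p r t(2) in \<open>auto simp: b\<close>)
  finally have "measure M (X -` ?E \<inter> space M) \<le> ?B"
    using B0 by (simp add: emeasure_eq_measure)
  moreover have "X -` ?E \<inter> space M = {\<omega> \<in> space M. X \<omega> \<bullet> (A *v X \<omega>) - trace A > t}"
    by auto
  moreover have "2 * real p = real (rank A) - real k" using r by simp
  ultimately show ?thesis by (simp add: p_def)
qed

end
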